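(* Let $n,m\ge1$, $M=\{1,\dots,m\}$, and for $0\le k\le m$ let $q_k(u)=u^TA_ku+2b_k^Tu+c_k$ ($u\in\mathbb{R}^n$), where $A_k$ is a real symmetric $n\times n$ matrix, $b_k\in\mathbb{R}^n$, $c_k\in\mathbb{R}$ and $c_0=0$. Consider the equality constrained QCQP in nonnegative variables, $\hat\zeta=\inf\{q_0(u): q_k(u)=0\ (k\in M),\ u\ge 0\}$, in its equivalent lifted form in $x\in\mathbb{R}^{1+n}$, together with its primal DNN relaxation (value $\hat\eta_p$), dual DNN relaxation (value $\hat\eta_d$), Lagrangian function $\widehat L$ and Lagrangian dual (value $\hat\varphi$), all as defined in the context. Consider the conditions: ($\widehat{\rm A}$) There exists a saddle point of $\widehat L$, i.e. an $(x,y,s,Z)\in\mathbb{R}^{1+n}\times\widehat G$ with $\sup_{(y',s',Z')\in\widehat G}\widehat L(x,y',s',Z')=\widehat L(x,y,s,Z)=\inf_{x'\in\mathbb{R}^{1+n}}\widehat L(x',y,s,Z)$. ($\widehat{\rm B}$) The primal DNN relaxation is exact, the dual DNN relaxation has an optimal solution $(y,s,Z)$, and $\hat\eta_d=\hat\eta_p$ (strong duality). ($\widehat{\rm C}$) The primal DNN relaxation is exact. ($\widehat{\rm D}$) $-\infty<\hat\eta_p=\hat\zeta<\infty$. ($\widehat{\rm E}$) $-\infty<\hat\eta_d=\hat\zeta<\infty$. ($\widehat{\rm F}$) $-\infty<\hat\varphi=\hat\zeta<\infty$. Consider also the assumptions: ($\hat{\rm a}$) (Slater constraint qualification) $\{X\in\widehat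 F: X\in\mathbb{S}^{1+n}_{++},\ X_{ij}>0\ (1\le i,j\le n)\}\ne\emptyset$. ($\hat{\rm b}$) The lifted QCQP has a minimizer $x$ when $\hat\zeta$ is finite. Then the following hold: 1. ($\widehat{\rm A}$) $\Leftrightarrow$ ($\widehat{\rm B}$). 2. ($\widehat{\rm B}$) $\Rightarrow$ ($\widehat{\rm C}$); and if ($\hat{\rm a}$) holds, then ($\widehat{\rm C}$) $\Rightarrow$ ($\widehat{\rm B}$). 3. ($\widehat{\rm C}$) $\Rightarrow$ ($\widehat{\rm D}$); and if ($\hat{\rm b}$) holds, then ($\widehat{\rm D}$) $\Rightarrow$ ($\widehat{\rm C}$). 4. ($\widehat{\rm E}$) $\Rightarrow$ ($\widehat{\rm D}$); and if ($\widehat{\rm B}$) holds, then ($\widehat{\rm D}$) $\Rightarrow$ ($\widehat{\rm E}$). 5. ($\widehat{\rm E}$) $\Leftrightarrow$ ($\widehat{\rm F}$).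
   Context: Let $\mathbb{S}^{1+n}$ be the space of real symmetric $(1+n)\times(1+n)$ matrices, with row and column indices $0,1,\dots,n$; let $\mathbb{S}^{1+n}_+$ and $\mathbb{S}^{1+n}_{++}$ be the cones of positive semidefinite and positive definite matrices in it, and let $\mathbb{N}=\{X\in\mathbb{S}^{1+n}: X\ge O\}$ be the cone of entrywise nonnegative symmetric matrices. $Q\bullet X=\sum_{i,j}Q_{ij}X_{ij}$; matrix inequalities $\ge O$ are entrywise. Infima and suprema take values in $[-\infty,+\infty]$, with $\inf\emptyset=+\infty$ and $\sup\emptyset=-\infty$. Data matrices: $Q_k=\begin{pmatrix}c_k&b_k^T\\ b_k&A_k\end{pmatrix}\in\mathbb{S}^{1+n}$ ($0\le k\le m$), and $H\in\mathbb{S}^{1+n}$ has $H_{00}=1$ and all other entries $0$. Let $\widehat F=\{X\in\mathbb{S}^{1+n}: Q_k\bullet X=0\ (k\in M),\ H\bullet X=1\}$. Lifted QCQP (same optimal value as the QCQP in $u$): $\hat\zeta=\inf\{Q_0\bullet xx^T: x\in\mathbb{R}^{1+n},\ xx^T\ge O,\ xx^T\in\widehat F\}$. Primal DNN (doubly nonnegative) relaxation: $\hat\eta_p=\inf\{Q_0\bullet X: X\in\mathbb{S}^{1+n}_+\cap\mathbb{N},\ X\in\widehat F\}$. It is called exact if it has a rank-1 optimal solution $X=xx^T$ with $x\in\mathbb{R}^{1+n}$. Dual DNN relaxation: $\hat\eta_d=\sup\{s: Q_0-\sum_{k\in M}y_kQ_k-sH\in\mathbb{S}^{1+n}_++\mathbb{N},\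 (y,s)\in\mathbb{R}^{m+1}\}$. Equivalently, one maximizes $s$ over $(y,s,Z)\in\mathbb{R}^m\times\mathbb{R}\times\mathbb{N}$ with $Q_0-\sum_{k\in M}y_kQ_k-sH-Z\in\mathbb{S}^{1+n}_+$; an optimal solution $(y,s,Z)$ is meant in this sense. Let $\widehat G=\mathbb{R}^{m+1}\times\mathbb{N}$ (the set of all $(y,s,Z)$ with $y\in\mathbb{R}^m$, $s\in\mathbb{R}$, $Z\in\mathbb{N}$). Lagrangian function: for $x\in\mathbb{R}^{1+n}$, $y\in\mathbb{R}^m$, $s\in\mathbb{R}$, $Z\in\mathbb{S}^{1+n}$, $$\widehat L(x,y,s,Z)=Q_0\bullet xx^T-\sum_{k\in M}y_k\,Q_k\bullet xx^T-Z\bullet xx^T-s\,(H\bullet xx^T-1).$$ Lagrangian dual: $\hat\varphi=\sup_{(y,s,Z)\in\widehat G}\ \inf_{x\in\mathbb{R}^{1+n}}\widehat L(x,y,s,Z)$.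
   Formalization: In assumption (â) the Slater point X is also required to lie in N, i.e. X_{0j} ≥ 0; without this, (Ĉ)⇒(B̂) fails, e.g. for n=2, m=1, q_0=-2u_1u_2, q_1=u_1²+u_1 (primal exact, dual infeasible). *)

theory Defs
  imports "HOL-Analysis.Analysis"
begin

(* Conventions. Vectors in R^n are indexed by the finite type 'n. The index set {0,1,...,n} is
   'n option, with None for 0 and Some i for i in {1..n}. Likewise the index set {0,1,...,m} of the
   data is 'm option, with None for 0 (objective) and Some k for k in M = {1..m} (constraints).
   All types are nonempty, so n >= 1 and m >= 1.
   The product Q \<bullet> X is the library inner product of real^'k^'k; see inner_matrix. *)

lemma inner_matrix:
  fixes Q X :: "real ^ 'k ^ 'k"
  shows "Q \<bullet> X = (\<Sum>i\<in>UNIV. \<Sum>j\<in>UNIV. Q $ i $ j * X $ i $ j)"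
  by (simp add: inner_vec_def)

definition sym_mat :: "(real ^ 'k ^ 'k) set" where
  "sym_mat = {X. transpose X = X}"

definition psd_mat :: "(real ^ 'k ^ 'k) set" where
  "psd_mat = {X \<in> sym_mat. \<forall>v. 0 \<le> v \<bullet> (X *v v)}"

definition pd_mat :: "(real ^ 'k ^ 'k) set" where
  "pd_mat = {X \<in> sym_mat. \<forall>v. v \<noteq> 0 \<longrightarrow> 0 < v \<bullet> (X *v v)}"

definition nonneg_mat :: "(real ^ 'k ^ 'k) set" where
  "nonneg_mat = {X \<in> sym_mat. \<forall>i j. 0 \<le> X $ i $ j}"

definition outer :: "real ^ 'k \<Rightarrow> real ^ 'k ^ 'k" where
  "outer x = (\<chi> i j. x $ i * x $ j)"

definition qfun :: "real ^ 'n ^ 'n \<Rightarrow> real ^ 'n \<Rightarrow> real \<Rightarrow> real ^ 'n \<Rightarrow> real" where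
  "qfun A b c u = u \<bullet> (A *v u) + 2 * (b \<bullet> u) + c"

definition block_mat ::
    "real ^ 'n ^ 'n \<Rightarrow> real ^ 'n \<Rightarrow> real \<Rightarrow> real ^ ('n::finite option) ^ ('n::finite option)" where
  "block_mat A b c = (\<chi> i j.
     case i of
       None \<Rightarrow> (case j of None \<Rightarrow> c | Some j' \<Rightarrow> b $ j')
     | Some i' \<Rightarrow> (case j of None \<Rightarrow> b $ i' | Some j' \<Rightarrow> A $ i' $ j'))"

definition Hmat :: "real ^ ('n::finite option) ^ ('n::finite option)" where
  "Hmat = (\<chi> i j. if i = None \<and> j = None then 1 else 0)"

definition Fhat :: "('m::finite option \<Rightarrow> real ^ ('n::finite option) ^ ('n::finite option)) \<Rightarrow>
    (real ^ ('n::finite option) ^ ('n::finite option)) set" where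
  "Fhat Q = {X \<in> sym_mat. (\<forall>k. Q (Some k) \<bullet> X = 0) \<and> Hmat \<bullet> X = 1}"

definition qcqp_val ::
    "('m::finite option \<Rightarrow> real ^ 'n ^ 'n) \<Rightarrow> ('m option \<Rightarrow> real ^ 'n) \<Rightarrow> ('m option \<Rightarrow> real) \<Rightarrow> ereal" where
  "qcqp_val A b c =
     (INF u \<in> {u. (\<forall>k. qfun (A (Some k)) (b (Some k)) (c (Some k)) u = 0) \<and> (\<forall>i. 0 \<le> u $ i)}.
        ereal (qfun (A None) (b None) (c None) u))"

definition lifted_feasible ::
    "('m::finite option \<Rightarrow> real ^ ('n::finite option) ^ ('n::finite option)) \<Rightarrow> (real ^ ('n::finite option)) set" where
  "lifted_feasible Q = {x. (\<forall>i j. 0 \<le> outer x $ i $ j) \<and> outer x \<in> Fhat Q}"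

definition lifted_val :: "('m::finite option \<Rightarrow> real ^ ('n::finite option) ^ ('n::finite option)) \<Rightarrow> ereal" where
  "lifted_val Q = (INF x \<in> lifted_feasible Q. ereal (Q None \<bullet> outer x))"

definition lifted_minimizer ::
    "('m::finite option \<Rightarrow> real ^ ('n::finite option) ^ ('n::finite option)) \<Rightarrow> real ^ ('n::finite option) \<Rightarrow> bool" where
  "lifted_minimizer Q x \<longleftrightarrow> x \<in> lifted_feasible Q \<and>
     (\<forall>x' \<in> lifted_feasible Q. Q None \<bullet> outer x \<le> Q None \<bullet> outer x')"

definition primal_feasible :: "('m::finite option \<Rightarrow> real ^ ('n::finite option) ^ ('n::finite option)) \<Rightarrow>
    (real ^ ('n::finite option) ^ ('n::finite option)) set" where
  "primal_feasible Q = psd_mat \<inter> nonneg_mat \<inter> Fhat Q"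

definition primal_val :: "('m::finite option \<Rightarrow> real ^ ('n::finite option) ^ ('n::finite option)) \<Rightarrow> ereal" where
  "primal_val Q = (INF X \<in> primal_feasible Q. ereal (Q None \<bullet> X))"

definition primal_optimal :: "('m::finite option \<Rightarrow> real ^ ('n::finite option) ^ ('n::finite option)) \<Rightarrow>
    real ^ ('n::finite option) ^ ('n::finite option) \<Rightarrow> bool" where
  "primal_optimal Q X \<longleftrightarrow> X \<in> primal_feasible Q \<and>
     (\<forall>X' \<in> primal_feasible Q. Q None \<bullet> X \<le> Q None \<bullet> X')"

definition primal_exact :: "('m::finite option \<Rightarrow> real ^ ('n::finite option) ^ ('n::finite option)) \<Rightarrow> bool" where
  "primal_exact Q \<longleftrightarrow> (\<exists>X x. primal_optimal Q X \<and> rank X = 1 \<and> X = outer x)"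

definition dual_slack :: "('m::finite option \<Rightarrow> real ^ ('n::finite option) ^ ('n::finite option)) \<Rightarrow>
    real ^ 'm \<Rightarrow> real \<Rightarrow> real ^ ('n::finite option) ^ ('n::finite option)" where
  "dual_slack Q y s = Q None - (\<Sum>k\<in>UNIV. (y $ k) *\<^sub>R Q (Some k)) - s *\<^sub>R Hmat"

(* The cone is the dual cone of S_+ \<inter> N. With the open cone S_++ in place of S_+ the program
   would not be equivalent to its (y, s, Z) form: if all data matrices vanish, the former is
   infeasible while the latter has value 0. *)
definition dual_val :: "('m::finite option \<Rightarrow> real ^ ('n::finite option) ^ ('n::finite option)) \<Rightarrow> ereal" where
  "dual_val Q = (SUP (y, s) \<in> {(y, s). dual_slack Q y s \<in> {P + Z | P Z. P \<in> psd_mat \<and> Z \<in> nonneg_mat}}.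
     ereal s)"

definition Ghat ::
    "((real ^ 'm) \<times> real \<times> (real ^ ('n::finite option) ^ ('n::finite option))) set" where
  "Ghat = {(y, s, Z). Z \<in> nonneg_mat}"

definition dual_feasible :: "('m::finite option \<Rightarrow> real ^ ('n::finite option) ^ ('n::finite option)) \<Rightarrow>
    ((real ^ 'm) \<times> real \<times> (real ^ ('n::finite option) ^ ('n::finite option))) set" where
  "dual_feasible Q = {(y, s, Z) \<in> Ghat. dual_slack Q y s - Z \<in> psd_mat}"

definition dual_optimal :: "('m::finite option \<Rightarrow> real ^ ('n::finite option) ^ ('n::finite option)) \<Rightarrow>
    real ^ 'm \<Rightarrow> real \<Rightarrow> real ^ ('n::finite option) ^ ('n::finite option) \<Rightarrow> bool" where
  "dual_optimal Q y s Z \<longleftrightarrow> (y, s, Z) \<in> dual_feasible Q \<and>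
     (\<forall>(y', s', Z') \<in> dual_feasible Q. s' \<le> s)"

definition Lhat :: "('m::finite option \<Rightarrow> real ^ ('n::finite option) ^ ('n::finite option)) \<Rightarrow>
    real ^ ('n::finite option) \<Rightarrow> real ^ 'm \<Rightarrow> real \<Rightarrow> real ^ ('n::finite option) ^ ('n::finite option) \<Rightarrow> real" where
  "Lhat Q x y s Z = Q None \<bullet> outer x - (\<Sum>k\<in>UNIV. y $ k * (Q (Some k) \<bullet> outer x))
     - Z \<bullet> outer x - s * (Hmat \<bullet> outer x - 1)"

definition lagrangian_val :: "('m::finite option \<Rightarrow> real ^ ('n::finite option) ^ ('n::finite option)) \<Rightarrow> ereal" where
  "lagrangian_val Q = (SUP (y, s, Z) \<in> Ghat. INF x. ereal (Lhat Q x y s Z))"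

definition saddle_point :: "('m::finite option \<Rightarrow> real ^ ('n::finite option) ^ ('n::finite option)) \<Rightarrow>
    real ^ ('n::finite option) \<Rightarrow> real ^ 'm \<Rightarrow> real \<Rightarrow> real ^ ('n::finite option) ^ ('n::finite option) \<Rightarrow> bool" where
  "saddle_point Q x y s Z \<longleftrightarrow> (y, s, Z) \<in> Ghat \<and>
     (SUP (y', s', Z') \<in> Ghat. ereal (Lhat Q x y' s' Z')) = ereal (Lhat Q x y s Z) \<and>
     ereal (Lhat Q x y s Z) = (INF x'. ereal (Lhat Q x' y s Z))"

definition condA :: "('m::finite option \<Rightarrow> real ^ ('n::finite option) ^ ('n::finite option)) \<Rightarrow> bool" where
  "condA Q \<longleftrightarrow> (\<exists>x y s Z. saddle_point Q x y s Z)"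

definition condB :: "('m::finite option \<Rightarrow> real ^ ('n::finite option) ^ ('n::finite option)) \<Rightarrow> bool" where
  "condB Q \<longleftrightarrow> primal_exact Q \<and> (\<exists>y s Z. dual_optimal Q y s Z) \<and> dual_val Q = primal_val Q"

definition condC :: "('m::finite option \<Rightarrow> real ^ ('n::finite option) ^ ('n::finite option)) \<Rightarrow> bool" where
  "condC Q \<longleftrightarrow> primal_exact Q"

definition condD :: "('m::finite option \<Rightarrow> real ^ ('n::finite option) ^ ('n::finite option)) \<Rightarrow> bool" where
  "condD Q \<longleftrightarrow> - \<infinity> < primal_val Q \<and> primal_val Q = lifted_val Q \<and> lifted_val Q < \<infinity>"

definition condE :: "('m::finite option \<Rightarrow> real ^ ('n::finite option) ^ ('n::finite option)) \<Rightarrow> bool" where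
  "condE Q \<longleftrightarrow> - \<infinity> < dual_val Q \<and> dual_val Q = lifted_val Q \<and> lifted_val Q < \<infinity>"

definition condF :: "('m::finite option \<Rightarrow> real ^ ('n::finite option) ^ ('n::finite option)) \<Rightarrow> bool" where
  "condF Q \<longleftrightarrow> - \<infinity> < lagrangian_val Q \<and> lagrangian_val Q = lifted_val Q \<and> lifted_val Q < \<infinity>"

(* A Slater point has to be feasible for the DNN relaxation, i.e. also X_0j >= 0; positivity is
   required strictly for the indices 1 <= i, j <= n only. Without X \<in> nonneg_mat, condC would not
   imply condB: for n = 2, m = 1, q_0(u) = - 2 u_1 u_2 and q_1(u) = u_1^2 + u_1, the point
   X = ((1, -1/2, 0), (-1/2, 1/2, 1), (0, 1, 5)) of Fhat is positive definite and the relaxation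
   has the optimal solution H, but its dual is infeasible. *)
definition slater :: "('m::finite option \<Rightarrow> real ^ ('n::finite option) ^ ('n::finite option)) \<Rightarrow> bool" where
  "slater Q \<longleftrightarrow>
     {X \<in> Fhat Q. X \<in> nonneg_mat \<and> X \<in> pd_mat \<and> (\<forall>i j. 0 < X $ Some i $ Some j)} \<noteq> {}"

definition lifted_attained :: "('m::finite option \<Rightarrow> real ^ ('n::finite option) ^ ('n::finite option)) \<Rightarrow> bool" where
  "lifted_attained Q \<longleftrightarrow> (\<bar>lifted_val Q\<bar> \<noteq> \<infinity> \<longrightarrow> (\<exists>x. lifted_minimizer Q x))"

lemma UNIV_option_sum:
  fixes f :: "'k::finite option \<Rightarrow> 'a::comm_monoid_add"
  shows "(\<Sum>i\<in>UNIV. f i) = f None + (\<Sum>i\<in>UNIV. f (Some i))"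
  by (simp add: UNIV_option_conv sum.reindex)

lemma block_mat_inner_outer:
  fixes x :: "real ^ ('n::finite option)"
  assumes "x $ None ^ 2 = 1"
  shows "block_mat A b c \<bullet> outer x = qfun A b c (\<chi> i. x $ None * x $ Some i)"
proof -
  let ?t = "x $ None"
  let ?B = "\<Sum>i\<in>UNIV. b $ i * (?t * x $ Some i)"
  have t: "?t * ?t = 1" using assms by (simp add: power2_eq_square)
  have tt: "(?t * r) * (?t * w) = r * w" for r w
  proof -
    have "(?t * r) * (?t * w) = (?t * ?t) * (r * w)" by (simp only: ac_simps)
    then show ?thesis by (simp only: t mult_1)
  qed
  have "block_mat A b c \<bullet> outer x
      = c * (?t * ?t) + ?B + (\<Sum>i\<in>UNIV. b $ i * (x $ Some i * ?t)
        + (\<Sum>j\<in>UNIV. A $ i $ j * (x $ Some i * x $ Some j)))"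
    by (simp add: inner_matrix UNIV_option_sum block_mat_def outer_def)
  also have "\<dots> = c + 2 * ?B + (\<Sum>i\<in>UNIV. \<Sum>j\<in>UNIV. A $ i $ j * (x $ Some i * x $ Some j))"
    by (simp add: t sum.distrib mult.commute [of "x $ Some _" ?t])
  also have "(\<Sum>i\<in>UNIV. \<Sum>j\<in>UNIV. A $ i $ j * (x $ Some i * x $ Some j))
      = (\<Sum>i\<in>UNIV. \<Sum>j\<in>UNIV. A $ i $ j * ((?t * x $ Some i) * (?t * x $ Some j)))"
    by (simp only: tt)
  also have "\<dots> = (\<chi> i. ?t * x $ Some i) \<bullet> (A *v (\<chi> i. ?t * x $ Some i))"
    unfolding inner_vec_def matrix_vector_mult_def
    by (simp add: sum_distrib_left mult.left_commute)
  finally show ?thesis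
    by (simp add: qfun_def inner_vec_def)
qed

lemma Hmat_inner_outer: "Hmat \<bullet> outer x = x $ None ^ 2"
  by (simp add: inner_matrix UNIV_option_sum Hmat_def outer_def power2_eq_square)

lemma transpose_outer: "transpose (outer x) = outer x"
  by (simp add: transpose_def outer_def vec_eq_iff mult.commute)

(* the QCQP in u and the lifted QCQP have the same optimal value *)
lemma qcqp_val_eq_lifted_val:
  fixes A :: "'m::finite option \<Rightarrow> real ^ 'n ^ 'n"
  shows "qcqp_val A b c = lifted_val (\<lambda>k. block_mat (A k) (b k) (c k))"
proof (rule antisym)
  let ?Q = "\<lambda>k. block_mat (A k) (b k) (c k)"
  show "qcqp_val A b c \<le> lifted_val ?Q"
    unfolding lifted_val_def
  proof (rule INF_greatest)
    fix x assume x: "x \<in> lifted_feasible ?Q"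
    then have x0: "x $ None ^ 2 = 1"
      by (simp add: lifted_feasible_def Fhat_def Hmat_inner_outer)
    let ?u = "\<chi> i. x $ None * x $ Some i"
    have "?u \<in> {u. (\<forall>k. qfun (A (Some k)) (b (Some k)) (c (Some k)) u = 0) \<and> (\<forall>i. 0 \<le> u $ i)}"
    proof -
      have "qfun (A (Some k)) (b (Some k)) (c (Some k)) ?u = 0" for k
        using x by (simp add: lifted_feasible_def Fhat_def block_mat_inner_outer [OF x0, symmetric])
      moreover have "0 \<le> ?u $ i" for i
        using x by (simp add: lifted_feasible_def outer_def)
      ultimately show ?thesis by blast
    qed
    then show "qcqp_val A b c \<le> ereal (?Q None \<bullet> outer x)"
      unfolding qcqp_val_def block_mat_inner_outer [OF x0] by (rule INF_lower)
  qed
  show "lifted_val ?Q \<le> qcqp_val A b c"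
    unfolding qcqp_val_def
  proof (rule INF_greatest)
    fix u
    assume u: "u \<in> {u. (\<forall>k. qfun (A (Some k)) (b (Some k)) (c (Some k)) u = 0) \<and> (\<forall>i. 0 \<le> u $ i)}"
    define x :: "real ^ ('n::finite option)" where "x = (\<chi> i. case i of None \<Rightarrow> 1 | Some j \<Rightarrow> u $ j)"
    have x0: "x $ None ^ 2 = 1" by (simp add: x_def)
    have xu: "(\<chi> i. x $ None * x $ Some i) = u" by (simp add: x_def vec_eq_iff)
    have "0 \<le> outer x $ i $ j" for i j
      using u by (auto simp: outer_def x_def split: option.split)
    then have "x \<in> lifted_feasible ?Q"
      using u x0 by (auto simp: lifted_feasible_def Fhat_def sym_mat_def transpose_outer
          Hmat_inner_outer block_mat_inner_outer [OF x0] xu)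
    then have "lifted_val ?Q \<le> ereal (?Q None \<bullet> outer x)"
      unfolding lifted_val_def by (rule INF_lower)
    then show "lifted_val ?Q \<le> ereal (qfun (A None) (b None) (c None) u)"
      by (simp add: block_mat_inner_outer [OF x0] xu)
  qed
qed

lemma dual_val_eq_triples:
  "dual_val Q = (SUP (y, s, Z) \<in> dual_feasible Q. ereal s)"
proof (rule antisym)
  show "dual_val Q \<le> (SUP (y, s, Z) \<in> dual_feasible Q. ereal s)"
    unfolding dual_val_def
  proof (rule SUP_least)
    fix p
    assume "p \<in> {(y, s). dual_slack Q y s \<in> {P + Z | P Z. P \<in> psd_mat \<and> Z \<in> nonneg_mat}}"
    then obtain y s P Z where p: "p = (y, s)" "dual_slack Q y s = P + Z" "P \<in> psd_mat" "Z \<in> nonneg_mat"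
      by blast
    then have "(y, s, Z) \<in> dual_feasible Q"
      by (simp add: dual_feasible_def Ghat_def)
    then have "(case (y, s, Z) of (y, s, Z) \<Rightarrow> ereal s) \<le> (SUP (y, s, Z) \<in> dual_feasible Q. ereal s)"
      by (rule SUP_upper)
    then show "(case p of (y, s) \<Rightarrow> ereal s) \<le> (SUP (y, s, Z) \<in> dual_feasible Q. ereal s)"
      by (simp add: p(1))
  qed
  show "(SUP (y, s, Z) \<in> dual_feasible Q. ereal s) \<le> dual_val Q"
  proof (rule SUP_least)
    fix p
    assume "p \<in> dual_feasible Q"
    then obtain y s Z where p: "p = (y, s, Z)" "Z \<in> nonneg_mat" "dual_slack Q y s - Z \<in> psd_mat"
      by (auto simp: dual_feasible_def Ghat_def)
    have "dual_slack Q y s = (dual_slack Q y s - Z) + Z"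
      by simp
    then have "(y, s) \<in> {(y, s). dual_slack Q y s \<in> {P + Z | P Z. P \<in> psd_mat \<and> Z \<in> nonneg_mat}}"
      using p by blast
    then have "(case (y, s) of (y, s) \<Rightarrow> ereal s) \<le> dual_val Q"
      unfolding dual_val_def by (rule SUP_upper)
    then show "(case p of (y, s, Z) \<Rightarrow> ereal s) \<le> dual_val Q"
      by (simp add: p(1))
  qed
qed

end

theory Submission
  imports Defs
begin

text \<open>
  Everything rests on two facts about the cone \<open>psd_mat\<close>.

  It is generated by the rank-one matrices \<open>outer v\<close> (\<open>psd_mat_eq_convex_cone_hull\<close>, by symmetric
  Gaussian elimination). Hence it is contained in its own dual cone, which gives weak duality
  (\<open>weak_duality\<close>) and with it the chain \<open>dual_val Q \<le> primal_val Q \<le> lifted_val Q\<close>. The relations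
  among (C), (D) and (E) are bookkeeping with this chain. Since the Lagrangian is a quadratic form
  in \<open>x\<close> plus the constant \<open>s\<close>, its infimum over \<open>x\<close> is \<open>s\<close> at a dual feasible point and \<open>- \<infinity>\<close>
  elsewhere (\<open>INF_Lhat\<close>); so the Lagrangian dual is the dual relaxation, and a saddle point is
  precisely a lifted feasible \<open>x\<close> together with a dual feasible point of the same value
  (\<open>saddle_point_iff\<close>). This settles (E) against (F) and (A) against (B).

  The remaining implication, from (C) to (B), needs the Slater point. A positive definite matrix
  bounds its sublevel sets in \<open>psd_mat\<close> (\<open>psd_mat_sublevel_compact\<close>), so the sum of \<open>psd_mat\<close> and any
  closed set on which that matrix is nonnegative is closed (\<open>closed_psd_mat_plus\<close>). Applied to the
  finitely generated cone of all normals to the linear constraints, this makes the dual cone of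
  the homogenized relaxation closed, and separation yields an attained dual with no duality gap
  (\<open>slater_dual_attained\<close>).
\<close>

section \<open>The cone of positive semidefinite matrices\<close>

lemma inner_outer: "outer v \<bullet> X = v \<bullet> (X *v v)"
  unfolding inner_vec_def matrix_vector_mult_def outer_def
  by (simp add: sum_distrib_left mult_ac)

lemma outer_scaleR: "outer (t *\<^sub>R v) = t\<^sup>2 *\<^sub>R outer v"
  by (simp add: outer_def vec_eq_iff power2_eq_square)

lemma outer_mult_vec: "outer x *v v = (x \<bullet> v) *\<^sub>R x"
  by (simp add: outer_def vec_eq_iff matrix_vector_mult_def inner_vec_def sum_distrib_right
      sum_distrib_left mult_ac)

lemma norm_outer: "norm (outer v) = (norm v)\<^sup>2"
proof -
  have "(norm (outer v))\<^sup>2 = ((norm v)\<^sup>2)\<^sup>2"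
    by (simp add: power2_norm_eq_inner inner_outer outer_mult_vec) (simp add: power2_eq_square)
  then show ?thesis
    by (subst (asm) power2_eq_iff_nonneg) auto
qed

lemma rank_outer:
  assumes "x \<noteq> 0"
  shows "rank (outer x) = 1"
proof -
  have "range ((*v) (outer x)) = span {x}"
  proof (intro equalityI subsetI)
    fix w assume "w \<in> span {x}"
    then obtain t where t: "w = t *\<^sub>R x"
      by (auto simp: span_singleton)
    have "outer x *v ((t / (x \<bullet> x)) *\<^sub>R x) = w"
      using assms by (simp add: t outer_mult_vec)
    then show "w \<in> range ((*v) (outer x))"
      by blast
  qed (auto simp: outer_mult_vec span_singleton)
  then show ?thesis
    using assms by (simp add: rank_dim_range dim_span)
qed

lemma subspace_sym_mat: "subspace sym_mat"
  by (auto simp: subspace_def sym_mat_def transpose_def vec_eq_iff)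

lemma outer_in_sym_mat: "outer v \<in> sym_mat"
  by (simp add: sym_mat_def transpose_outer)

lemma Hmat_in_sym_mat: "Hmat \<in> sym_mat"
  by (auto simp: Hmat_def sym_mat_def transpose_def vec_eq_iff)

lemma inner_sym_mat_transpose:
  assumes "S \<in> sym_mat"
  shows "S \<bullet> transpose X = S \<bullet> X"
proof -
  have "S $ i $ j = S $ j $ i" for i j
    using assms by (simp add: sym_mat_def transpose_def vec_eq_iff)
  then have "S \<bullet> transpose X = (\<Sum>i\<in>UNIV. \<Sum>j\<in>UNIV. S $ j $ i * X $ j $ i)"
    by (simp add: inner_matrix transpose_def)
  also have "\<dots> = S \<bullet> X"
    unfolding inner_matrix by (rule sum.swap)
  finally show ?thesis .
qed

lemma psd_mat_iff: "X \<in> psd_mat \<longleftrightarrow> X \<in> sym_mat \<and> (\<forall>v. 0 \<le> outer v \<bullet> X)"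
  by (simp add: psd_mat_def inner_outer)

lemma outer_in_psd_mat: "outer x \<in> psd_mat"
  by (simp add: psd_mat_iff outer_in_sym_mat) (simp add: inner_outer outer_mult_vec inner_commute)

lemma convex_cone_psd_mat: "convex_cone psd_mat"
  using subspace_sym_mat
  by (auto simp: convex_cone_iff psd_mat_iff subspace_def inner_add_right)

lemma convex_cone_nonneg_mat: "convex_cone nonneg_mat"
  using subspace_sym_mat
  by (auto simp: convex_cone_iff nonneg_mat_def subspace_def)

lemma closed_psd_mat: "closed psd_mat"
proof -
  have eq: "psd_mat = sym_mat \<inter> (\<Inter>v. {X. outer v \<bullet> X \<ge> 0})"
    by (auto simp: psd_mat_iff)
  show ?thesis
    unfolding eq
    by (intro closed_Int closed_subspace subspace_sym_mat closed_INT ballI closed_halfspace_ge)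
qed

lemma quadratic_form_line:
  assumes "X \<in> sym_mat"
  shows "outer (v + t *\<^sub>R axis k 1) \<bullet> X = outer v \<bullet> X + 2 * t * (X $ k \<bullet> v) + t\<^sup>2 * X $ k $ k"
proof -
  have k: "axis k 1 \<bullet> (X *v w) = X $ k \<bullet> w" for w
    by (simp add: inner_axis') (simp add: matrix_vector_mult_def inner_vec_def)
  have "v \<bullet> (X *v axis k 1) = (transpose X *v v) \<bullet> axis k 1"
    by (metis dot_lmul_matrix transpose_matrix_vector)
  also have "\<dots> = X $ k \<bullet> v"
    using assms k by (simp add: sym_mat_def inner_commute)
  finally have "v \<bullet> (X *v axis k 1) = X $ k \<bullet> v" .
  then show ?thesis
    by (simp add: inner_outer matrix_vector_right_distrib inner_add_left inner_add_right k
        matrix_vector_mult_scaleR inner_axis power2_eq_square algebra_simps)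
qed

lemma psd_mat_diag_nonneg:
  assumes "X \<in> psd_mat"
  shows "0 \<le> X $ k $ k"
  using assms quadratic_form_line[of X 0 1 k]
  by (simp add: psd_mat_iff) (metis add.left_neutral inner_outer inner_zero_left)

text \<open>The quadratic form is affine along \<open>v + t e\<^sub>k\<close> when the diagonal entry at \<open>k\<close> vanishes, so it can only
  stay nonnegative if its slope is zero.\<close>
lemma psd_mat_zero_diag:
  assumes "X \<in> psd_mat" "X $ k $ k = 0"
  shows "X $ k = 0"
proof (rule ccontr)
  assume "X $ k \<noteq> 0"
  let ?a = "X $ k \<bullet> X $ k" and ?q = "outer (X $ k) \<bullet> X"
  have a: "?a > 0"
    using \<open>X $ k \<noteq> 0\<close> by simp
  define t where "t = - (?q + 1) / (2 * ?a)"
  have "outer (X $ k + t *\<^sub>R axis k 1) \<bullet> X = ?q + 2 * t * ?a"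
    using assms by (subst quadratic_form_line) (auto simp: psd_mat_iff)
  also have "\<dots> = - 1"
    using a unfolding t_def by (simp add: field_simps)
  finally show False
    using assms(1) by (metis psd_mat_iff neg_0_le_iff_le not_one_le_zero)
qed

text \<open>One step of symmetric Gaussian elimination: the Schur complement of a positive diagonal entry.\<close>
lemma psd_mat_schur_complement:
  assumes X: "X \<in> psd_mat" and pos: "X $ k $ k > 0"
  shows "X - (1 / X $ k $ k) *\<^sub>R outer (X $ k) \<in> psd_mat"
  unfolding psd_mat_iff
proof (intro conjI allI)
  show "X - (1 / X $ k $ k) *\<^sub>R outer (X $ k) \<in> sym_mat"
    using X by (intro subspace_diff subspace_scale subspace_sym_mat outer_in_sym_mat)
      (simp add: psd_mat_iff)
  fix v
  let ?a = "X $ k \<bullet> v" and ?d = "X $ k $ k"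
  \<comment> \<open>The minimum over \<open>t\<close> of the form at \<open>v + t e\<^sub>k\<close> is the form of the Schur complement at \<open>v\<close>.\<close>
  have "0 \<le> outer (v + (- ?a / ?d) *\<^sub>R axis k 1) \<bullet> X"
    using X by (simp add: psd_mat_iff)
  also have "\<dots> = outer v \<bullet> X + 2 * (- ?a / ?d) * ?a + (- ?a / ?d)\<^sup>2 * ?d"
    using X by (subst quadratic_form_line) (auto simp: psd_mat_iff)
  also have "\<dots> = outer v \<bullet> X - ?a\<^sup>2 / ?d"
    using pos by (simp add: power2_eq_square)
  also have "?a\<^sup>2 = outer v \<bullet> outer (X $ k)"
    by (simp add: inner_outer outer_mult_vec power2_eq_square inner_commute)
  finally show "0 \<le> outer v \<bullet> (X - (1 / ?d) *\<^sub>R outer (X $ k))"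
    by (simp add: inner_diff_right)
qed

text \<open>Eliminating the diagonal entries one after the other writes the matrix as a sum of rank-one
  matrices; a row that has been cleared stays cleared.\<close>
lemma psd_mat_eq_convex_cone_hull: "psd_mat = convex_cone hull (range outer)"
proof
  show "convex_cone hull (range outer) \<subseteq> psd_mat"
    by (intro hull_minimal convex_cone_psd_mat) (auto simp: outer_in_psd_mat)
  show "psd_mat \<subseteq> convex_cone hull (range outer)"
  proof
    fix X :: "real ^ 'k ^ 'k" assume "X \<in> psd_mat"
    then show "X \<in> convex_cone hull (range outer)"
    proof (induction "card {i. X $ i $ i \<noteq> 0}" arbitrary: X rule: less_induct)
      case less
      show ?case
      proof (cases "\<exists>k. X $ k $ k \<noteq> 0")
        case False
        then have "X = 0"
          using psd_mat_zero_diag[OF less.prems] by (simp add: vec_eq_iff)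
        then show ?thesis
          by (simp add: convex_cone_hull_contains_0)
      next
        case True
        then obtain k where k: "X $ k $ k \<noteq> 0" by blast
        then have pos: "X $ k $ k > 0"
          using psd_mat_diag_nonneg[OF less.prems, of k] by simp
        define Y where "Y = X - (1 / X $ k $ k) *\<^sub>R outer (X $ k)"
        have Y: "Y \<in> psd_mat"
          unfolding Y_def using less.prems pos by (rule psd_mat_schur_complement)
        have Yk: "Y $ k $ k = 0"
          using k by (simp add: Y_def outer_def)
        have "Y $ i $ i = 0" if "X $ i $ i = 0" for i
        proof -
          have "X $ i $ k = 0"
            using psd_mat_zero_diag[OF less.prems that] by simp
          moreover have "X $ k $ i = X $ i $ k"
            using less.prems by (simp add: psd_mat_iff sym_mat_def transpose_def vec_eq_iff)
          ultimately show ?thesis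
            using that by (simp add: Y_def outer_def)
        qed
        then have "{i. Y $ i $ i \<noteq> 0} \<subset> {i. X $ i $ i \<noteq> 0}"
          using k Yk by blast
        then have "Y \<in> convex_cone hull (range outer)"
          using less.hyps[OF _ Y] by (simp add: psubset_card_mono)
        then have "Y + (1 / X $ k $ k) *\<^sub>R outer (X $ k) \<in> convex_cone hull (range outer)"
          using pos by (intro convex_cone_hull_add convex_cone_hull_mul) (auto intro: hull_inc)
        then show ?thesis
          by (simp add: Y_def)
      qed
    qed
  qed
qed

lemma psd_mat_inner_nonneg:
  assumes "W \<in> psd_mat" "X \<in> psd_mat"
  shows "0 \<le> W \<bullet> X"
proof -
  have "convex_cone hull (range outer) \<subseteq> {W. X \<bullet> W \<ge> 0}"
    using assms(2) by (intro hull_minimal convex_cone_halfspace_ge)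
      (auto simp: psd_mat_iff inner_commute)
  then show ?thesis
    using assms(1) by (auto simp: psd_mat_eq_convex_cone_hull inner_commute)
qed

lemma nonneg_mat_inner_nonneg:
  assumes "Z \<in> nonneg_mat" "\<And>i j. 0 \<le> X $ i $ j"
  shows "0 \<le> Z \<bullet> X"
  unfolding inner_matrix using assms by (intro sum_nonneg mult_nonneg_nonneg) (auto simp: nonneg_mat_def)

section \<open>Closedness of the dual cone\<close>

lemma pd_mat_coercive:
  assumes "X \<in> pd_mat"
  obtains e where "e > 0" "\<And>v. e * (norm v)\<^sup>2 \<le> outer v \<bullet> X"
proof -
  have "continuous_on (sphere 0 1) (\<lambda>v. v \<bullet> (X *v v))"
    by (intro continuous_intros linear_continuous_on matrix_vector_mul_bounded_linear)
  then obtain u where u: "u \<in> sphere 0 1"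
      "\<And>v. v \<in> sphere 0 1 \<Longrightarrow> u \<bullet> (X *v u) \<le> v \<bullet> (X *v v)"
    using continuous_attains_inf[of "sphere 0 1" "\<lambda>v. v \<bullet> (X *v v)"] by auto
  have "u \<noteq> 0"
    using u(1) by auto
  have "(u \<bullet> (X *v u)) * (norm v)\<^sup>2 \<le> outer v \<bullet> X" for v
  proof (cases "v = 0")
    case False
    define w where "w = (1 / norm v) *\<^sub>R v"
    have "u \<bullet> (X *v u) \<le> outer w \<bullet> X"
      using u(2)[of w] False by (simp add: w_def inner_outer)
    then have "(u \<bullet> (X *v u)) * (norm v)\<^sup>2 \<le> (outer w \<bullet> X) * (norm v)\<^sup>2"
      by (rule mult_right_mono) simp
    also have "\<dots> = outer v \<bullet> X"
      using False by (simp add: w_def outer_scaleR power_divide)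
    finally show ?thesis .
  qed (simp add: inner_outer)
  then show thesis
    using that \<open>u \<noteq> 0\<close> assms by (auto simp: pd_mat_def)
qed

text \<open>A positive definite matrix is an interior point of the cone, which is its own dual; as a functional
  it therefore dominates a multiple of the norm there, as is seen on the generators \<open>outer v\<close>.\<close>
lemma psd_mat_sublevel_compact:
  assumes "X \<in> pd_mat"
  shows "compact {W \<in> psd_mat. X \<bullet> W \<le> B}"
proof -
  obtain e where e: "e > 0" "\<And>v. e * (norm v)\<^sup>2 \<le> outer v \<bullet> X"
    using pd_mat_coercive[OF assms] by blast
  have cc: "convex_cone {W. e * norm W \<le> X \<bullet> W}"
    unfolding convex_cone_iff
  proof (intro conjI ballI allI impI)
    fix W V assume "W \<in> {W. e * norm W \<le> X \<bullet> W}" "V \<in> {W. e * norm W \<le> X \<bullet> W}"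
    moreover have "e * norm (W + V) \<le> e * norm W + e * norm V"
      using e(1) norm_triangle_ineq[of W V] by (simp flip: distrib_left)
    ultimately show "W + V \<in> {W. e * norm W \<le> X \<bullet> W}"
      by (simp add: inner_add_right)
  next
    fix W and c :: real assume "W \<in> {W. e * norm W \<le> X \<bullet> W}" "0 \<le> c"
    then show "c *\<^sub>R W \<in> {W. e * norm W \<le> X \<bullet> W}"
      using mult_left_mono[of "e * norm W" "X \<bullet> W" c] by (simp add: mult_ac)
  qed auto
  have "convex_cone hull (range outer) \<subseteq> {W. e * norm W \<le> X \<bullet> W}"
    using e(2) cc by (intro hull_minimal) (auto simp: norm_outer inner_commute)
  then have "norm W \<le> B / e" if "W \<in> psd_mat" "X \<bullet> W \<le> B" for W
    using that e(1) by (force simp: psd_mat_eq_convex_cone_hull field_simps)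
  then have "bounded {W \<in> psd_mat. X \<bullet> W \<le> B}"
    by (auto simp: bounded_iff)
  moreover have "{W \<in> psd_mat. X \<bullet> W \<le> B} = psd_mat \<inter> {W. X \<bullet> W \<le> B}"
    by auto
  ultimately show ?thesis
    by (simp add: compact_eq_bounded_closed closed_Int closed_psd_mat closed_halfspace_le)
qed

lemma closed_psd_mat_plus:
  assumes X: "X \<in> pd_mat" and "closed C" and C: "\<And>V. V \<in> C \<Longrightarrow> 0 \<le> X \<bullet> V"
  shows "closed {W + V | W V. W \<in> psd_mat \<and> V \<in> C}" (is "closed ?K")
  unfolding closed_sequential_limits
proof (intro allI impI, elim conjE)
  fix f l assume f: "\<forall>n. f n \<in> ?K" and lim: "f \<longlonglongrightarrow> l"
  have "(\<lambda>n. X \<bullet> f n) \<longlonglongrightarrow> X \<bullet> l"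
    by (intro tendsto_intros lim)
  then have "bounded (range (\<lambda>n. X \<bullet> f n))"
    by (rule convergent_imp_bounded)
  then obtain B where B: "\<And>n. X \<bullet> f n \<le> B"
    by (fastforce simp: bounded_iff abs_le_iff)
  let ?S = "\<Union>W\<in>{W \<in> psd_mat. X \<bullet> W \<le> B}. \<Union>V\<in>C. {W + V}"
  have "f n \<in> ?S" for n
  proof -
    obtain W V where WV: "f n = W + V" "W \<in> psd_mat" "V \<in> C"
      using f by blast
    then have "X \<bullet> W \<le> B"
      using B[of n] C[of V] by (simp add: inner_add_right)
    then show ?thesis
      using WV by blast
  qed
  moreover have "closed ?S"
    by (rule compact_closed_sums[OF psd_mat_sublevel_compact[OF X] \<open>closed C\<close>])
  ultimately have "l \<in> ?S"
    using lim by (metis (no_types, lifting) closed_sequentially)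
  then show "l \<in> ?K"
    by blast
qed


text \<open>The pairing with \<open>sym_unit i j\<close> reads off an entry of a symmetric matrix, up to the factor 2.\<close>
definition sym_unit :: "'k \<Rightarrow> 'k \<Rightarrow> real ^ ('k::finite) ^ ('k::finite)" where
  "sym_unit i j = axis i (axis j 1) + axis j (axis i 1)"

lemma inner_sym_unit: "sym_unit i j \<bullet> X = X $ i $ j + X $ j $ i"
  by (simp add: sym_unit_def inner_add_left inner_axis')

lemma sym_unit_in_nonneg_mat: "sym_unit i j \<in> nonneg_mat"
  by (auto simp: sym_unit_def nonneg_mat_def sym_mat_def transpose_def vec_eq_iff axis_def)

text \<open>Nonnegativity and the equality constraints together are polyhedral. The cone generated by their
  finitely many normals is closed because it is finitely generated. This is why a Slater point has to
  be interior to the semidefinite cone but may lie on the boundary of the nonnegative one.\<close>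
definition constraint_cone ::
    "('m::finite option \<Rightarrow> real ^ ('k::finite) ^ ('k::finite)) \<Rightarrow> (real ^ 'k ^ 'k) set" where
  "constraint_cone Q = convex_cone hull
     (range (\<lambda>(i, j). sym_unit i j) \<union> range (\<lambda>k. Q (Some k)) \<union> range (\<lambda>k. - Q (Some k)))"

lemma closed_constraint_cone: "closed (constraint_cone Q)"
  unfolding constraint_cone_def by (rule closed_convex_cone_hull) simp

lemma constraint_cone_decompose:
  assumes "V \<in> constraint_cone Q"
  obtains y :: "real ^ ('m::finite)" and Z
  where "Z \<in> nonneg_mat" "V = (\<Sum>k\<in>UNIV. y $ k *\<^sub>R Q (Some k)) + Z"
proof -
  let ?D = "{(\<Sum>k\<in>UNIV. y $ k *\<^sub>R Q (Some k)) + Z | (y :: real ^ 'm) Z. Z \<in> nonneg_mat}"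
  have N: "0 \<in> nonneg_mat" "\<And>Z Z'. Z \<in> nonneg_mat \<Longrightarrow> Z' \<in> nonneg_mat \<Longrightarrow> Z + Z' \<in> nonneg_mat"
    "\<And>Z t. Z \<in> nonneg_mat \<Longrightarrow> 0 \<le> t \<Longrightarrow> t *\<^sub>R Z \<in> nonneg_mat"
    using convex_cone_nonneg_mat by (auto simp: convex_cone_iff)
  have memI: "U \<in> ?D" if "Z \<in> nonneg_mat" "U = (\<Sum>k\<in>UNIV. y $ k *\<^sub>R Q (Some k)) + Z"
    for U Z and y :: "real ^ 'm"
    using that by blast
  have unit: "(\<Sum>k\<in>UNIV. (axis l t :: real ^ 'm) $ k *\<^sub>R Q (Some k)) = t *\<^sub>R Q (Some l)" for l t
    by (subst sum.remove[of _ l]) (auto simp: axis_def)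
  have "constraint_cone Q \<subseteq> ?D"
    unfolding constraint_cone_def
  proof (rule hull_minimal)
    have "sym_unit i j \<in> ?D" for i j
      by (rule memI[of "sym_unit i j" _ 0]) (simp_all add: sym_unit_in_nonneg_mat)
    moreover have "Q (Some k) \<in> ?D" for k
      by (rule memI[OF N(1), of _ "axis k 1"]) (simp add: unit)
    moreover have "- Q (Some k) \<in> ?D" for k
      by (rule memI[OF N(1), of _ "axis k (- 1)"]) (simp add: unit)
    ultimately show "range (\<lambda>(i, j). sym_unit i j) \<union> range (\<lambda>k. Q (Some k)) \<union> range (\<lambda>k. - Q (Some k)) \<subseteq> ?D"
      by (simp only: Un_subset_iff) (simp only: image_subset_iff split_beta ball_UNIV simp_thms)
    show "convex_cone ?D"
      unfolding convex_cone_iff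
    proof (intro conjI ballI allI impI)
      show "0 \<in> ?D"
        by (rule memI[OF N(1), of _ 0]) simp
    next
      fix U V assume "U \<in> ?D" "V \<in> ?D"
      then obtain y Z y' Z' where "Z \<in> nonneg_mat" "U = (\<Sum>k\<in>UNIV. (y :: real ^ 'm) $ k *\<^sub>R Q (Some k)) + Z"
        "Z' \<in> nonneg_mat" "V = (\<Sum>k\<in>UNIV. (y' :: real ^ 'm) $ k *\<^sub>R Q (Some k)) + Z'"
        by blast
      then show "U + V \<in> ?D"
        by (intro memI[of "Z + Z'" _ "y + y'"])
          (simp_all add: N scaleR_add_left sum.distrib algebra_simps)
    next
      fix U and t :: real assume "U \<in> ?D" "0 \<le> t"
      then obtain y Z where "Z \<in> nonneg_mat" "U = (\<Sum>k\<in>UNIV. (y :: real ^ 'm) $ k *\<^sub>R Q (Some k)) + Z"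
        by blast
      then show "t *\<^sub>R U \<in> ?D"
        using \<open>0 \<le> t\<close> by (intro memI[of "t *\<^sub>R Z" _ "t *\<^sub>R y"])
          (simp_all add: N scaleR_add_right scaleR_sum_right)
    qed
  qed
  then show thesis
    using assms that by blast
qed

lemma inner_constraint_cone_nonneg:
  assumes "V \<in> constraint_cone Q" "X \<in> nonneg_mat" "\<And>k. Q (Some k) \<bullet> X = 0"
  shows "0 \<le> X \<bullet> V"
proof -
  obtain y and Z where Z: "Z \<in> nonneg_mat" "V = (\<Sum>k\<in>UNIV. y $ k *\<^sub>R Q (Some k)) + Z"
    using constraint_cone_decompose[OF assms(1)] .
  then have "X \<bullet> V = Z \<bullet> X"
    using assms(3) by (simp add: inner_add_right inner_sum_right inner_commute[of X])
  then show ?thesis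
    using nonneg_mat_inner_nonneg[of Z X] Z(1) assms(2) by (simp add: nonneg_mat_def)
qed

section \<open>Weak and strong duality\<close>

lemma dual_slack_inner:
  "dual_slack Q y s \<bullet> X
     = Q None \<bullet> X - (\<Sum>k\<in>UNIV. y $ k * (Q (Some k) \<bullet> X)) - s * (Hmat \<bullet> X)"
  by (simp add: dual_slack_def inner_diff_left inner_sum_left)

lemma weak_duality:
  assumes X: "X \<in> primal_feasible Q" and yZ: "(y, s, Z) \<in> dual_feasible Q"
  shows "s \<le> Q None \<bullet> X"
proof -
  have "0 \<le> (dual_slack Q y s - Z) \<bullet> X"
    using X yZ by (intro psd_mat_inner_nonneg) (auto simp: primal_feasible_def dual_feasible_def)
  moreover have "0 \<le> Z \<bullet> X"
    using X yZ by (intro nonneg_mat_inner_nonneg)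
      (auto simp: primal_feasible_def dual_feasible_def Ghat_def nonneg_mat_def)
  ultimately show ?thesis
    using X by (simp add: inner_diff_left dual_slack_inner primal_feasible_def Fhat_def)
qed

text \<open>Homogenization: adding \<open>Y\<close> to a feasible matrix and normalizing the corner entry gives a
  feasible matrix again. For \<open>Hmat \<bullet> Y = 0\<close> this covers the recession directions.\<close>
lemma primal_optimal_homogenize:
  assumes opt: "primal_optimal Q X" and Y: "Y \<in> psd_mat" "Y \<in> nonneg_mat" "\<And>k. Q (Some k) \<bullet> Y = 0"
  shows "(Q None \<bullet> X) * (Hmat \<bullet> Y) \<le> Q None \<bullet> Y"
proof -
  have H: "Hmat \<bullet> Y = Y $ None $ None"
    by (simp add: inner_matrix UNIV_option_sum Hmat_def)
  then have h: "0 \<le> Hmat \<bullet> Y"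
    using Y(2) by (simp add: nonneg_mat_def)
  let ?t = "1 / (1 + Hmat \<bullet> Y)"
  have X: "X \<in> psd_mat" "X \<in> nonneg_mat" "\<And>k. Q (Some k) \<bullet> X = 0" "Hmat \<bullet> X = 1"
    using opt by (auto simp: primal_optimal_def primal_feasible_def Fhat_def)
  have "?t *\<^sub>R (X + Y) \<in> psd_mat" "?t *\<^sub>R (X + Y) \<in> nonneg_mat"
    using X Y h convex_cone_psd_mat convex_cone_nonneg_mat
    by (auto intro!: convex_cone_scaleR convex_cone_add)
  then have "?t *\<^sub>R (X + Y) \<in> primal_feasible Q"
    using X Y h by (simp add: primal_feasible_def Fhat_def inner_add_right psd_mat_iff)
  then have "Q None \<bullet> X \<le> ?t * (Q None \<bullet> (X + Y))"
    using opt by (auto simp: primal_optimal_def)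
  then have "(Q None \<bullet> X) * (1 + Hmat \<bullet> Y) \<le> Q None \<bullet> (X + Y)"
    using h by (simp add: pos_le_divide_eq)
  then show ?thesis
    by (simp add: inner_add_right distrib_left)
qed

text \<open>A dual solution with value \<open>v\<close>, the primal optimum, is the same as a decomposition of
  \<open>Q None - v *\<^sub>R Hmat\<close> in \<open>psd_mat + constraint_cone Q\<close>. The Slater point makes this cone closed; a
  hyperplane separating the given matrix from it would, once symmetrized, be a matrix contradicting optimality.\<close>
lemma slater_dual_attained:
  assumes QS: "\<And>k. Q k \<in> sym_mat" and "slater Q" and opt: "primal_optimal Q X"
  obtains y Z where "(y, Q None \<bullet> X, Z) \<in> dual_feasible Q"
proof -
  let ?v = "Q None \<bullet> X"
  let ?f = "Q None - ?v *\<^sub>R Hmat"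
  let ?K = "{W + V | W V. W \<in> psd_mat \<and> V \<in> constraint_cone Q}"
  have memI: "W + V \<in> ?K" if "W \<in> psd_mat" "V \<in> constraint_cone Q" for W V
    using that by blast
  obtain X0 where X0: "X0 \<in> Fhat Q" "X0 \<in> nonneg_mat" "X0 \<in> pd_mat"
    using \<open>slater Q\<close> by (auto simp: slater_def)
  have "closed ?K"
    using X0(3) closed_constraint_cone
    by (rule closed_psd_mat_plus) (use X0 in \<open>auto simp: Fhat_def intro: inner_constraint_cone_nonneg\<close>)
  have gen: "sym_unit i j \<in> constraint_cone Q" "Q (Some k) \<in> constraint_cone Q"
    "- Q (Some k) \<in> constraint_cone Q" for i j k
    by (auto simp: constraint_cone_def intro!: hull_inc)
  have zero: "0 \<in> psd_mat" "0 \<in> constraint_cone Q"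
    using convex_cone_psd_mat by (auto simp: constraint_cone_def convex_cone_iff convex_cone_hull_contains_0)
  have K_eq: "?K = (\<Union>W\<in>psd_mat. \<Union>V\<in>constraint_cone Q. {W + V})"
    by blast
  have cone: "convex_cone ?K"
    unfolding K_eq unfolding constraint_cone_def
    by (intro convex_cone_sums convex_cone_psd_mat convex_cone_convex_cone_hull)
  have "?f \<in> ?K"
  proof (rule ccontr)
    assume "?f \<notin> ?K"
    then obtain Y b where Y: "Y \<bullet> ?f < b" "\<forall>V\<in>?K. b < Y \<bullet> V"
      using separating_hyperplane_closed_point[of ?K ?f] cone \<open>closed ?K\<close>
      by (auto simp only: convex_cone_def)
    have "b < 0"
      using Y(2) memI[OF zero] by fastforce
    have pos: "0 \<le> Y \<bullet> V" if "V \<in> ?K" for V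
    proof (rule ccontr)
      assume neg: "\<not> 0 \<le> Y \<bullet> V"
      then have "(b / (Y \<bullet> V)) *\<^sub>R V \<in> ?K"
        using \<open>b < 0\<close> by (intro convex_cone_scaleR[OF cone] that) (simp add: divide_nonpos_neg)
      with Y(2) have "b < Y \<bullet> ((b / (Y \<bullet> V)) *\<^sub>R V)"
        by (rule bspec)
      also have "\<dots> = b"
        using neg by simp
      finally show False
        by simp
    qed
    define X' where "X' = (1 / 2) *\<^sub>R (Y + transpose Y)"
    have X'_sym: "X' \<in> sym_mat"
      by (simp add: X'_def sym_mat_def transpose_def vec_eq_iff)
    have X'_inner: "S \<bullet> X' = Y \<bullet> S" if "S \<in> sym_mat" for S
      using that by (simp add: X'_def inner_add_right inner_sym_mat_transpose inner_commute)
    have "X' \<in> psd_mat"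
      using pos[OF memI[OF outer_in_psd_mat zero(2)]] X'_sym
      by (simp add: psd_mat_iff X'_inner outer_in_sym_mat)
    moreover have "X' \<in> nonneg_mat"
    proof -
      have "0 \<le> sym_unit i j \<bullet> X'" for i j
        using pos[OF memI[OF zero(1) gen(1)]] sym_unit_in_nonneg_mat[of i j]
        by (simp add: X'_inner nonneg_mat_def)
      moreover have "X' $ j $ i = X' $ i $ j" for i j
        using X'_sym by (simp add: sym_mat_def transpose_def vec_eq_iff)
      ultimately show ?thesis
        using X'_sym by (simp add: nonneg_mat_def inner_sym_unit)
    qed
    moreover have "Q (Some k) \<bullet> X' = 0" for k
      using pos[OF memI[OF zero(1) gen(2)[of k]]] pos[OF memI[OF zero(1) gen(3)[of k]]]
      by (simp add: X'_inner QS)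
    ultimately have "?v * (Hmat \<bullet> X') \<le> Q None \<bullet> X'"
      using primal_optimal_homogenize[OF opt] by blast
    then have "0 \<le> Y \<bullet> ?f"
      by (simp add: X'_inner[OF QS] X'_inner[OF Hmat_in_sym_mat] inner_diff_right)
    then show False
      using Y(1) \<open>b < 0\<close> by simp
  qed
  then obtain W V where WV: "?f = W + V" "W \<in> psd_mat" "V \<in> constraint_cone Q"
    by blast
  then obtain y Z where "Z \<in> nonneg_mat" "V = (\<Sum>k\<in>UNIV. y $ k *\<^sub>R Q (Some k)) + Z"
    using constraint_cone_decompose by blast
  moreover from this have "dual_slack Q y ?v - Z = W"
    using WV(1) by (simp add: dual_slack_def algebra_simps)
  ultimately have "(y, ?v, Z) \<in> dual_feasible Q"
    using WV(2) by (simp add: dual_feasible_def Ghat_def)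
  then show thesis
    by (rule that)
qed

section \<open>The Lagrangian\<close>

lemma Lhat_eq: "Lhat Q x y s Z = (dual_slack Q y s - Z) \<bullet> outer x + s"
  by (simp add: Lhat_def inner_diff_left dual_slack_inner algebra_simps)

lemma dual_slack_sym:
  assumes "\<And>k. Q k \<in> sym_mat" "Z \<in> nonneg_mat"
  shows "dual_slack Q y s - Z \<in> sym_mat"
  using assms unfolding dual_slack_def nonneg_mat_def
  by (intro subspace_diff subspace_sum subspace_scale subspace_sym_mat Hmat_in_sym_mat) auto

text \<open>Up to the constant \<open>s\<close> the Lagrangian is a quadratic form in \<open>x\<close>, which is unbounded below as
  soon as it takes a negative value.\<close>
lemma INF_Lhat:
  assumes QS: "\<And>k. Q k \<in> sym_mat" and G: "(y, s, Z) \<in> Ghat"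
  shows "(INF x. ereal (Lhat Q x y s Z)) = (if (y, s, Z) \<in> dual_feasible Q then ereal s else - \<infinity>)"
proof (cases "(y, s, Z) \<in> dual_feasible Q")
  case True
  have "(INF x. ereal (Lhat Q x y s Z)) = ereal s"
  proof (rule antisym)
    have "(INF x. ereal (Lhat Q x y s Z)) \<le> ereal (Lhat Q 0 y s Z)"
      by (rule INF_lower) simp
    then show "(INF x. ereal (Lhat Q x y s Z)) \<le> ereal s"
      by (simp add: Lhat_eq inner_commute[of _ "outer 0"] inner_outer)
    show "ereal s \<le> (INF x. ereal (Lhat Q x y s Z))"
      using True by (intro INF_greatest)
        (simp add: Lhat_eq dual_feasible_def psd_mat_iff inner_commute)
  qed
  then show ?thesis
    using True by simp
next
  case False
  let ?P = "dual_slack Q y s - Z"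
  have "?P \<in> sym_mat"
    using dual_slack_sym[OF QS] G by (simp add: Ghat_def)
  then obtain v where v: "?P \<bullet> outer v < 0"
    using False G by (auto simp: dual_feasible_def psd_mat_iff inner_commute not_le)
  have "(INF x. ereal (Lhat Q x y s Z)) \<le> ereal B" for B
  proof -
    define t where "t = sqrt (\<bar>B - s\<bar> / - (?P \<bullet> outer v))"
    have "t\<^sup>2 = \<bar>B - s\<bar> / - (?P \<bullet> outer v)"
      unfolding t_def using v by (intro real_sqrt_pow2 divide_nonneg_nonneg) auto
    then have "t\<^sup>2 * (?P \<bullet> outer v) = - \<bar>B - s\<bar>"
      using v by simp
    then have "Lhat Q (t *\<^sub>R v) y s Z \<le> B"
      by (simp add: Lhat_eq outer_scaleR)
    then show ?thesis
      by (meson INF_lower2 UNIV_I ereal_less_eq(3))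
  qed
  then show ?thesis
    using False by (simp add: ereal_bot)
qed

lemma lagrangian_val_eq_dual_val:
  assumes QS: "\<And>k. Q k \<in> sym_mat"
  shows "lagrangian_val Q = dual_val Q"
proof (rule antisym)
  show "lagrangian_val Q \<le> dual_val Q"
    unfolding lagrangian_val_def dual_val_eq_triples
    by (rule SUP_least) (auto simp: INF_Lhat[OF QS] intro: SUP_upper2)
  have "dual_feasible Q \<subseteq> Ghat"
    by (auto simp: dual_feasible_def)
  then show "dual_val Q \<le> lagrangian_val Q"
    unfolding lagrangian_val_def dual_val_eq_triples
    by (intro SUP_mono) (force simp: INF_Lhat[OF QS])
qed

text \<open>Maximality of the Lagrangian in the multipliers forces feasibility of \<open>x\<close>, because the Lagrangian is
  affine in each multiplier with the constraint residual as slope; minimality in \<open>x\<close> is dual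
  feasibility. Both sides of the saddle condition then collapse to the two objective values.\<close>
lemma saddle_point_iff:
  assumes QS: "\<And>k. Q k \<in> sym_mat"
  shows "saddle_point Q x y s Z \<longleftrightarrow>
    x \<in> lifted_feasible Q \<and> (y, s, Z) \<in> dual_feasible Q \<and> Q None \<bullet> outer x = s"
proof
  assume sp: "saddle_point Q x y s Z"
  then have G: "(y, s, Z) \<in> Ghat" and Z: "Z \<in> nonneg_mat"
    by (auto simp: saddle_point_def Ghat_def)
  have up: "Lhat Q x y' s' Z' \<le> Lhat Q x y s Z" if "Z' \<in> nonneg_mat" for y' s' Z'
  proof -
    have "(y', s', Z') \<in> Ghat"
      using that by (simp add: Ghat_def)
    then have "ereal (Lhat Q x y' s' Z') \<le> (SUP (y', s', Z') \<in> Ghat. ereal (Lhat Q x y' s' Z'))"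
      by (rule SUP_upper2) simp
    also have "\<dots> = ereal (Lhat Q x y s Z)"
      using sp by (simp only: saddle_point_def)
    finally show ?thesis
      by simp
  qed
  have "(INF x'. ereal (Lhat Q x' y s Z)) = ereal (Lhat Q x y s Z)"
    using sp by (simp add: saddle_point_def)
  then have D: "(y, s, Z) \<in> dual_feasible Q" and L: "Lhat Q x y s Z = s"
    by (auto simp: INF_Lhat[OF QS G] split: if_splits)
  have "Hmat \<bullet> outer x = 1"
    using up[OF Z, of y "s + 1"] up[OF Z, of y "s - 1"] by (simp add: Lhat_def algebra_simps)
  moreover have "Q (Some k) \<bullet> outer x = 0" for k
  proof -
    have shift: "(\<Sum>j\<in>UNIV. (y + axis k t) $ j * (Q (Some j) \<bullet> outer x))
      = (\<Sum>j\<in>UNIV. y $ j * (Q (Some j) \<bullet> outer x)) + t * (Q (Some k) \<bullet> outer x)" for t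
    proof -
      have "(\<Sum>j\<in>UNIV. axis k t $ j * (Q (Some j) \<bullet> outer x)) = t * (Q (Some k) \<bullet> outer x)"
        by (subst sum.remove[of _ k]) (auto simp: axis_def)
      then show ?thesis
        by (simp add: distrib_right sum.distrib)
    qed
    show ?thesis
      using up[OF Z, of "y + axis k 1" s] up[OF Z, of "y + axis k (- 1)" s]
      unfolding Lhat_def shift by simp
  qed
  moreover have "0 \<le> outer x $ i $ j" for i j
  proof -
    have "Z + sym_unit i j \<in> nonneg_mat"
      by (intro convex_cone_add convex_cone_nonneg_mat Z sym_unit_in_nonneg_mat)
    from up[OF this, of y s] have "0 \<le> sym_unit i j \<bullet> outer x"
      by (simp add: Lhat_def inner_add_left)
    then show ?thesis
      by (simp add: inner_sym_unit) (simp add: outer_def mult.commute)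
  qed
  ultimately have F: "x \<in> lifted_feasible Q"
    by (simp add: lifted_feasible_def Fhat_def outer_in_sym_mat)
  have "0 \<in> nonneg_mat"
    by (rule convex_cone_contains_0[OF convex_cone_nonneg_mat])
  from up[OF this, of y s] have "Q None \<bullet> outer x \<le> s"
    using F L by (simp add: Lhat_def lifted_feasible_def Fhat_def)
  moreover have "0 \<le> Z \<bullet> outer x"
    using F Z by (intro nonneg_mat_inner_nonneg) (auto simp: lifted_feasible_def)
  then have "s \<le> Q None \<bullet> outer x"
    using F L by (simp add: Lhat_def lifted_feasible_def Fhat_def)
  ultimately show "x \<in> lifted_feasible Q \<and> (y, s, Z) \<in> dual_feasible Q \<and> Q None \<bullet> outer x = s"
    using F D by simp
next
  assume asm: "x \<in> lifted_feasible Q \<and> (y, s, Z) \<in> dual_feasible Q \<and> Q None \<bullet> outer x = s"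
  then have G: "(y, s, Z) \<in> Ghat"
    by (simp add: dual_feasible_def)
  have L: "Lhat Q x y' s' Z' = s - Z' \<bullet> outer x" for y' s' Z'
    using asm by (simp add: Lhat_def lifted_feasible_def Fhat_def)
  have upper: "Lhat Q x y' s' Z' \<le> s" if "Z' \<in> nonneg_mat" for y' s' Z'
    using nonneg_mat_inner_nonneg[OF that, of "outer x"] asm by (simp add: L lifted_feasible_def)
  have inf: "(INF x'. ereal (Lhat Q x' y s Z)) = ereal s"
    using asm by (simp add: INF_Lhat[OF QS G])
  have "ereal s \<le> ereal (Lhat Q x y s Z)"
    unfolding inf[symmetric] by (rule INF_lower) simp
  moreover have "Z \<in> nonneg_mat"
    using G by (simp add: Ghat_def)
  ultimately have eq: "Lhat Q x y s Z = s"
    using upper[of Z y s] by simp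
  have "(SUP (y', s', Z') \<in> Ghat. ereal (Lhat Q x y' s' Z')) = ereal s"
  proof (rule antisym)
    show "(SUP (y', s', Z') \<in> Ghat. ereal (Lhat Q x y' s' Z')) \<le> ereal s"
      by (rule SUP_least) (auto simp: Ghat_def upper)
    show "ereal s \<le> (SUP (y', s', Z') \<in> Ghat. ereal (Lhat Q x y' s' Z'))"
      using G by (rule SUP_upper2) (simp add: eq)
  qed
  then show "saddle_point Q x y s Z"
    using G by (simp add: saddle_point_def inf eq)
qed

section \<open>Relations between the optimal values\<close>

lemma lifted_feasible_iff_primal_feasible: "x \<in> lifted_feasible Q \<longleftrightarrow> outer x \<in> primal_feasible Q"
  by (auto simp: lifted_feasible_def primal_feasible_def outer_in_psd_mat nonneg_mat_def outer_in_sym_mat)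

lemma primal_val_le_lifted_val: "primal_val Q \<le> lifted_val Q"
  unfolding primal_val_def lifted_val_def
  by (intro INF_greatest INF_lower) (simp add: lifted_feasible_iff_primal_feasible)

lemma dual_val_le_primal_val: "dual_val Q \<le> primal_val Q"
  unfolding dual_val_eq_triples primal_val_def
  by (intro SUP_least INF_greatest) (auto intro: weak_duality)

lemma primal_optimal_val:
  assumes "primal_optimal Q X"
  shows "primal_val Q = ereal (Q None \<bullet> X)"
  unfolding primal_val_def using assms
  by (intro antisym INF_greatest INF_lower) (auto simp: primal_optimal_def)

lemma dual_optimal_val:
  assumes "dual_optimal Q y s Z"
  shows "dual_val Q = ereal s"
  unfolding dual_val_eq_triples using assms
  by (intro antisym SUP_least SUP_upper2[of "(y, s, Z)"]) (auto simp: dual_optimal_def)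

text \<open>The corner entry of a feasible \<open>outer x\<close> is 1, so \<open>x\<close> is nonzero and the rank is 1.\<close>
lemma primal_exact_iff: "primal_exact Q \<longleftrightarrow> (\<exists>x. primal_optimal Q (outer x))"
proof -
  have "rank (outer x) = 1" if "primal_optimal Q (outer x)" for x
  proof (rule rank_outer)
    have "(x $ None)\<^sup>2 = 1"
      using that by (simp add: primal_optimal_def primal_feasible_def Fhat_def Hmat_inner_outer)
    then show "x \<noteq> 0"
      by auto
  qed
  then show ?thesis
    by (auto simp: primal_exact_def)
qed

lemma equal_values_condB:
  assumes x: "outer x \<in> primal_feasible Q" and D: "(y, Q None \<bullet> outer x, Z) \<in> dual_feasible Q"
  shows "condB Q"
proof -
  have "primal_optimal Q (outer x)"
    using x weak_duality[OF _ D] by (simp add: primal_optimal_def)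
  moreover have "dual_optimal Q y (Q None \<bullet> outer x) Z"
    using D weak_duality[OF x] by (auto simp: dual_optimal_def)
  ultimately show ?thesis
    using primal_optimal_val dual_optimal_val by (metis condB_def primal_exact_iff)
qed

lemma condA_iff_condB:
  assumes QS: "\<And>k. Q k \<in> sym_mat"
  shows "condA Q \<longleftrightarrow> condB Q"
proof
  assume "condA Q"
  then show "condB Q"
    using equal_values_condB
    by (auto simp: condA_def saddle_point_iff[OF QS] lifted_feasible_iff_primal_feasible)
next
  assume "condB Q"
  then obtain x y s Z where xs: "primal_optimal Q (outer x)" "dual_optimal Q y s Z"
    "dual_val Q = primal_val Q"
    by (auto simp: condB_def primal_exact_iff)
  then have "Q None \<bullet> outer x = s"
    using primal_optimal_val dual_optimal_val by fastforce
  then have "saddle_point Q x y s Z"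
    using xs by (simp add: saddle_point_iff[OF QS] lifted_feasible_iff_primal_feasible
        primal_optimal_def dual_optimal_def)
  then show "condA Q"
    by (auto simp: condA_def)
qed

lemma slater_condC_imp_condB:
  assumes QS: "\<And>k. Q k \<in> sym_mat" and "slater Q" "condC Q"
  shows "condB Q"
proof -
  obtain x where x: "primal_optimal Q (outer x)"
    using \<open>condC Q\<close> by (auto simp: condC_def primal_exact_iff)
  obtain y Z where "(y, Q None \<bullet> outer x, Z) \<in> dual_feasible Q"
    using slater_dual_attained[OF QS \<open>slater Q\<close> x] .
  then show ?thesis
    using x by (intro equal_values_condB) (auto simp: primal_optimal_def)
qed

lemma condC_imp_condD:
  assumes "condC Q"
  shows "condD Q"
proof -
  obtain x where x: "primal_optimal Q (outer x)"
    using assms by (auto simp: condC_def primal_exact_iff)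
  then have "x \<in> lifted_feasible Q"
    by (simp add: lifted_feasible_iff_primal_feasible primal_optimal_def)
  then have "lifted_val Q \<le> ereal (Q None \<bullet> outer x)"
    unfolding lifted_val_def by (rule INF_lower)
  then have "lifted_val Q = ereal (Q None \<bullet> outer x)"
    using primal_val_le_lifted_val[of Q] unfolding primal_optimal_val[OF x] by (rule order.antisym)
  then show ?thesis
    using primal_optimal_val[OF x] by (simp add: condD_def)
qed

lemma condD_imp_condC:
  assumes "lifted_attained Q" "condD Q"
  shows "condC Q"
proof -
  have "\<bar>lifted_val Q\<bar> \<noteq> \<infinity>"
    using assms(2) by (auto simp: condD_def)
  then obtain x where x: "lifted_minimizer Q x"
    using assms(1) by (auto simp: lifted_attained_def)
  have "ereal (Q None \<bullet> outer x) \<le> lifted_val Q"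
    unfolding lifted_val_def using x by (intro INF_greatest) (auto simp: lifted_minimizer_def)
  also have "\<dots> = primal_val Q"
    using assms(2) by (simp add: condD_def)
  finally have "Q None \<bullet> outer x \<le> Q None \<bullet> X" if "X \<in> primal_feasible Q" for X
    using that by (auto simp: primal_val_def le_INF_iff)
  then have "primal_optimal Q (outer x)"
    using x by (simp add: primal_optimal_def lifted_minimizer_def lifted_feasible_iff_primal_feasible)
  then show ?thesis
    by (auto simp: condC_def primal_exact_iff)
qed

lemma condE_imp_condD:
  assumes "condE Q"
  shows "condD Q"
proof -
  have "lifted_val Q \<le> primal_val Q"
    using assms dual_val_le_primal_val[of Q] unfolding condE_def by metis
  then have "primal_val Q = lifted_val Q"
    by (rule order.antisym[OF primal_val_le_lifted_val])
  then show ?thesis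
    using assms unfolding condD_def condE_def by metis
qed

lemma block_mat_sym:
  assumes "transpose A = A"
  shows "block_mat A b c \<in> sym_mat"
  using assms by (auto simp: sym_mat_def block_mat_def transpose_def vec_eq_iff split: option.split)

theorem mainTheorem2:
  fixes A :: "'m::finite option \<Rightarrow> real ^ 'n ^ 'n"
    and b :: "'m option \<Rightarrow> real ^ 'n"
    and c :: "'m option \<Rightarrow> real"
    and Q :: "'m option \<Rightarrow> real ^ ('n option) ^ ('n option)"
  assumes sym: "\<And>k. transpose (A k) = A k"
    and c0: "c None = 0"
    and Q: "\<And>k. Q k = block_mat (A k) (b k) (c k)"
  shows "(condA Q \<longleftrightarrow> condB Q)
    \<and> (condB Q \<longrightarrow> condC Q) \<and> (slater Q \<longrightarrow> condC Q \<longrightarrow> condB Q)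
    \<and> (condC Q \<longrightarrow> condD Q) \<and> (lifted_attained Q \<longrightarrow> condD Q \<longrightarrow> condC Q)
    \<and> (condE Q \<longrightarrow> condD Q) \<and> (condB Q \<longrightarrow> condD Q \<longrightarrow> condE Q)
    \<and> (condE Q \<longleftrightarrow> condF Q)"
proof -
  have QS: "Q k \<in> sym_mat" for k
    by (simp add: Q block_mat_sym sym)
  have EF: "condE Q \<longleftrightarrow> condF Q"
    by (simp add: condE_def condF_def lagrangian_val_eq_dual_val[OF QS])
  show ?thesis
  proof (intro conjI impI)
    show "condA Q \<longleftrightarrow> condB Q"
      by (rule condA_iff_condB[OF QS])
    show "condC Q" if "condB Q"
      using that by (simp add: condB_def condC_def)
    show "condB Q" if "slater Q" "condC Q"
      using QS that by (rule slater_condC_imp_condB)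
    show "condE Q" if "condB Q" "condD Q"
      using that unfolding condB_def condD_def condE_def by metis
  qed (auto intro: condC_imp_condD condD_imp_condC condE_imp_condD simp: EF)
qed

end
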